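(* In black-peg, non-adaptive Mastermind with no repeats, $\Omega(n\log k)$ guesses are required to identify the hidden sequence $H$. That is, there is an absolute constant $c>0$ such that for all integers $1\le n\le k$ and every finite collection of queries $Q_1,\dots,Q_s$ (sequences of length $n$ with pairwise distinct entries in $[k]=\{1,\dots,k\}$) which identifies every hidden sequence, one has $s\ge c\, n\log k$.
   Context: Let $\mathcal{V}$ be the set of sequences in $[k]^n$ with pairwise distinct entries. In black-peg, non-adaptive Mastermind with no repeats, the hidden sequence $H$ is an element of $\mathcal{V}$, and the codebreaker submits all queries $Q_1,\dots,Q_s\in\mathcal{V}$ at once. The codebreaker then receives all the responses $b(Q_1,H),\dots,b(Q_s,H)$, where $b(Q,H)=|\{i\in\{1,\dots,n\}: q_i=h_i\}|$, and must determine $H$ from them with no additional guesses. The collection $Q_1,\dots,Q_s$ identifies every hidden sequence if, for all $H,H'\in\mathcal{V}$, $b(Q_i,H)=b(Q_i,H')$ for all $1\le i\le s$ implies $H=H'$. *)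

theory Defs
  imports Complex_Main
begin

definition no_repeat_seqs :: "nat \<Rightarrow> nat \<Rightarrow> nat list set" where
  "no_repeat_seqs n k = {xs. length xs = n \<and> set xs \<subseteq> {1..k} \<and> distinct xs}"

text \<open>Positions are counted from 0 to \<open>length q - 1\<close>, following list indexing;
  the function is only meant for lists of equal length.\<close>

definition black_pegs :: "nat list \<Rightarrow> nat list \<Rightarrow> nat" where
  "black_pegs q h = card {i. i < length q \<and> q ! i = h ! i}"

text \<open>The queries are \<open>Q 1, \<dots>, Q s\<close>; values of \<open>Q\<close> outside \<open>{1..s}\<close> are irrelevant.\<close>

definition identifies_all ::
  "nat \<Rightarrow> nat \<Rightarrow> nat \<Rightarrow> (nat \<Rightarrow> nat list) \<Rightarrow> bool" where
  "identifies_all n k s Q \<longleftrightarrow>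
     (\<forall>H\<in>no_repeat_seqs n k. \<forall>H'\<in>no_repeat_seqs n k.
        (\<forall>i\<in>{1..s}. black_pegs (Q i) H = black_pegs (Q i) H') \<longrightarrow> H = H')"

end

theory Submission
  imports Defs "HOL-Library.FuncSet" "HOL-Combinatorics.Transposition"
begin

text \<open>For a uniformly random hidden sequence, each response has mean \<open>n / k \<le> 1\<close>, so it carries
  at most \<open>2\<close> bits of information, whereas the hidden sequence carries at least
  \<open>(n / 2) log\<^sub>2 k\<close> bits. The entropy bound is replaced by a Kraft inequality: giving
  a response \<open>j\<close> the codeword length \<open>j + 1\<close>, the identifying property yields
  \<open>\<Sum>\<^sub>H 2 powr (- L H) \<le> 1\<close>, where \<open>L H\<close> is the total codeword length of the responses to \<open>H\<close>;
  since \<open>L\<close> has mean at most \<open>2 s\<close>, convexity gives at most \<open>4 ^ s\<close> hidden sequences.\<close>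

lemma finite_no_repeat_seqs [simp]: "finite (no_repeat_seqs n k)"
proof (rule finite_subset)
  show "no_repeat_seqs n k \<subseteq> {xs. set xs \<subseteq> {1..k} \<and> length xs = n}"
    by (auto simp: no_repeat_seqs_def)
qed (rule finite_lists_length_eq, simp)

lemma black_pegs_le_length: "black_pegs q h \<le> length q"
  unfolding black_pegs_def using card_mono[of "{..<length q}" "{i. i < length q \<and> q ! i = h ! i}"]
  by auto

text \<open>The cardinality is a falling factorial. Squaring it and pairing each factor with its
  mirror image in the range gives \<open>n\<close> products, each at least \<open>k\<close> because
  \<open>(a + 1) * (b + 1)\<close> is at least \<open>a + b + 1\<close>.\<close>

lemma power_le_card_no_repeat_seqs_squared:
  assumes "n \<le> k"
  shows "k ^ n \<le> (card (no_repeat_seqs n k))\<^sup>2"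
proof -
  have "no_repeat_seqs n k = {xs. length xs = n \<and> distinct xs \<and> set xs \<subseteq> {1..k}}"
    by (auto simp: no_repeat_seqs_def)
  then have card: "card (no_repeat_seqs n k) = \<Prod>{k - n + 1..k}"
    using card_lists_distinct_length_eq[of "{1..k}" n] assms by simp
  have rev: "\<Prod>{k - n + 1..k} = (\<Prod>i\<in>{k - n + 1..k}. k - n + 1 + k - i)"
    by (rule prod.reindex_bij_witness[of _ "\<lambda>i. k - n + 1 + k - i" "\<lambda>i. k - n + 1 + k - i"]) auto
  have "k ^ n = (\<Prod>i\<in>{k - n + 1..k}. k)"
    using assms by simp
  also have "\<dots> \<le> (\<Prod>i\<in>{k - n + 1..k}. i * (k - n + 1 + k - i))"
  proof (rule prod_mono, safe)
    fix i assume i: "i \<in> {k - n + 1..k}"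
    define a b where "a = i - 1" and "b = k - i"
    have "i = a + 1" "k = a + 1 + b" using i by (auto simp: a_def b_def)
    moreover have "k - n + 1 + k - i \<ge> b + 1"
      using i by (auto simp: b_def)
    ultimately have "i * (k - n + 1 + k - i) \<ge> (a + 1) * (b + 1)"
      by (intro mult_mono) auto
    then show "k \<le> i * (k - n + 1 + k - i)"
      using \<open>k = a + 1 + b\<close> by simp
  qed
  also have "\<dots> = (card (no_repeat_seqs n k))\<^sup>2"
    unfolding prod.distrib rev[symmetric] card power2_eq_square ..
  finally show ?thesis .
qed

text \<open>Exchanging the values \<open>x\<close> and \<open>y\<close> throughout a sequence is
  injective and preserves distinctness. By symmetry all values are equally frequent at position
  \<open>i\<close>.\<close>

lemma card_no_repeat_seqs_entry_le:
  assumes "i < n" "x \<in> {1..k}" "y \<in> {1..k}"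
  shows "card {H \<in> no_repeat_seqs n k. H ! i = x} \<le> card {H \<in> no_repeat_seqs n k. H ! i = y}"
proof (rule card_inj_on_le)
  show "inj_on (map (transpose x y)) {H \<in> no_repeat_seqs n k. H ! i = x}"
    by (simp add: inj_on_subset[OF inj_mapI])
  show "map (transpose x y) ` {H \<in> no_repeat_seqs n k. H ! i = x}
      \<subseteq> {H \<in> no_repeat_seqs n k. H ! i = y}"
    using assms by (auto simp: no_repeat_seqs_def distinct_map transpose_def split: if_splits
        intro!: inj_onI)
qed simp

lemma card_no_repeat_seqs_entry:
  assumes "i < n" "x \<in> {1..k}"
  shows "k * card {H \<in> no_repeat_seqs n k. H ! i = x} = card (no_repeat_seqs n k)"
proof -
  have "no_repeat_seqs n k = (\<Union>y\<in>{1..k}. {H \<in> no_repeat_seqs n k. H ! i = y})"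
    using assms(1) nth_mem by (fastforce simp: no_repeat_seqs_def)
  then have "card (no_repeat_seqs n k)
      = card (\<Union>y\<in>{1..k}. {H \<in> no_repeat_seqs n k. H ! i = y})"
    by simp
  also have "\<dots> = (\<Sum>y\<in>{1..k}. card {H \<in> no_repeat_seqs n k. H ! i = y})"
    by (rule card_UN_disjoint) auto
  also have "\<dots> = (\<Sum>y\<in>{1..k}. card {H \<in> no_repeat_seqs n k. H ! i = x})"
    using assms by (intro sum.cong refl antisym card_no_repeat_seqs_entry_le) auto
  finally show ?thesis by simp
qed

text \<open>Double counting of pairs of a hidden sequence and a matching position: each of the
  \<open>n\<close> positions is matched by exactly one \<open>k\<close>-th of all sequences.\<close>

lemma sum_black_pegs_le:
  assumes "n \<le> k" "Q \<in> no_repeat_seqs n k"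
  shows "(\<Sum>H\<in>no_repeat_seqs n k. black_pegs Q H) \<le> card (no_repeat_seqs n k)"
proof (cases "k = 0")
  \<comment> \<open>Here \<open>n = 0\<close>, so there are no pegs; the main case ends by
    cancelling the factor \<open>k\<close>.\<close>
  case True
  then show ?thesis using assms by (simp add: black_pegs_def no_repeat_seqs_def)
next
  case False
  have Q: "length Q = n" "\<And>i. i < n \<Longrightarrow> Q ! i \<in> {1..k}"
    using assms(2) nth_mem by (fastforce simp: no_repeat_seqs_def)+
  have "(\<Sum>H\<in>no_repeat_seqs n k. black_pegs Q H)
      = (\<Sum>H\<in>no_repeat_seqs n k. \<Sum>i<n. if H ! i = Q ! i then 1 else 0)"
    unfolding black_pegs_def by (intro sum.cong refl)
      (auto simp: Q sum.If_cases intro!: arg_cong[where f = card])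
  also have "\<dots> = (\<Sum>i<n. \<Sum>H\<in>no_repeat_seqs n k. if H ! i = Q ! i then 1 else 0)"
    by (rule sum.swap)
  also have "\<dots> = (\<Sum>i<n. card {H \<in> no_repeat_seqs n k. H ! i = Q ! i})"
    by (intro sum.cong refl) (auto simp: sum.If_cases intro!: arg_cong[where f = card])
  finally have "k * (\<Sum>H\<in>no_repeat_seqs n k. black_pegs Q H) = n * card (no_repeat_seqs n k)"
    using card_no_repeat_seqs_entry Q(2) by (simp add: sum_distrib_left)
  also have "\<dots> \<le> k * card (no_repeat_seqs n k)"
    using assms(1) by simp
  finally show ?thesis using False by simp
qed

text \<open>Distinct hidden sequences have distinct response vectors, so the sum is bounded by the
  one over all vectors with entries in \<open>{..n}\<close>. The latter factors into
  \<open>s\<close> geometric sums, each below 1.\<close>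

lemma kraft_identifies_all:
  assumes Q: "\<And>i. i \<in> {1..s} \<Longrightarrow> Q i \<in> no_repeat_seqs n k"
    and ident: "identifies_all n k s Q"
  shows "(\<Sum>H\<in>no_repeat_seqs n k. \<Prod>i\<in>{1..s}. (1/2::real) ^ (black_pegs (Q i) H + 1)) \<le> 1"
proof -
  \<comment> \<open>Restriction fixes the value outside \<open>{1..s}\<close>, as membership in
    \<open>PiE\<close> demands.\<close>
  define R where "R = (\<lambda>H. restrict (\<lambda>i. black_pegs (Q i) H) {1..s})"
  have inj: "inj_on R (no_repeat_seqs n k)"
  proof (rule inj_onI)
    fix H H' assume H: "H \<in> no_repeat_seqs n k" "H' \<in> no_repeat_seqs n k" and "R H = R H'"
    then have "black_pegs (Q i) H = black_pegs (Q i) H'" if "i \<in> {1..s}" for i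
      using that unfolding R_def by (metis restrict_apply')
    with H ident show "H = H'" by (auto simp: identifies_all_def)
  qed
  have sub: "R ` no_repeat_seqs n k \<subseteq> PiE {1..s} (\<lambda>_. {..n})"
  proof -
    have "black_pegs (Q i) H \<le> n" if "i \<in> {1..s}" for i H
      using black_pegs_le_length[of "Q i" H] Q[OF that] by (simp add: no_repeat_seqs_def)
    then show ?thesis by (auto simp: R_def)
  qed
  have geo: "(\<Sum>j\<le>n. (1/2::real) ^ (j + 1)) = 1 - (1/2) ^ (n + 1)"
    by (induction n) auto
  have "(\<Sum>H\<in>no_repeat_seqs n k. \<Prod>i\<in>{1..s}. (1/2::real) ^ (black_pegs (Q i) H + 1))
      = (\<Sum>f\<in>R ` no_repeat_seqs n k. \<Prod>i\<in>{1..s}. (1/2) ^ (f i + 1))"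
    unfolding sum.reindex[OF inj] by (simp add: R_def)
  also have "\<dots> \<le> (\<Sum>f\<in>PiE {1..s} (\<lambda>_. {..n}). \<Prod>i\<in>{1..s}. (1/2) ^ (f i + 1))"
    by (rule sum_mono2[OF _ sub]) (auto intro!: finite_PiE prod_nonneg)
  also have "\<dots> = (\<Prod>i\<in>{1..s}. \<Sum>j\<le>n. (1/2) ^ (j + 1))"
    by (rule prod_sum_PiE[symmetric]) auto
  also have "\<dots> \<le> 1"
    unfolding geo by (intro prod_le_1) (simp add: power_le_one del: power_Suc)
  finally show ?thesis .
qed

lemma card_no_repeat_seqs_le_if_identifies_all:
  assumes "n \<le> k" and Q: "\<And>i. i \<in> {1..s} \<Longrightarrow> Q i \<in> no_repeat_seqs n k"
    and ident: "identifies_all n k s Q"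
  shows "card (no_repeat_seqs n k) \<le> 4 ^ s"
proof -
  let ?V = "no_repeat_seqs n k"
  define L where "L = (\<lambda>H. \<Sum>i\<in>{1..s}. black_pegs (Q i) H + 1)"
  have "(\<Sum>H\<in>?V. L H) = (\<Sum>i\<in>{1..s}. (\<Sum>H\<in>?V. black_pegs (Q i) H) + card ?V)"
    unfolding L_def by (subst sum.swap) (simp only: sum.distrib card_eq_sum)
  \<comment> \<open>Of the factor 2, one unit bounds the mean response and the other is the offset
    \<open>+ 1\<close> in the codeword length.\<close>
  also have "\<dots> \<le> (\<Sum>i\<in>{1..s}. 2 * card ?V)"
    using sum_black_pegs_le[OF assms(1) Q] by (intro sum_mono) fastforce
  finally have "(\<Sum>H\<in>?V. L H) \<le> 2 * s * card ?V"
    by (simp add: mult_ac)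
  then have "(\<Sum>H\<in>?V. real (L H)) \<le> 2 * real s * real (card ?V)"
    by (metis of_nat_le_iff of_nat_mult of_nat_numeral of_nat_sum)
  then have mean: "(\<Sum>H\<in>?V. 2 * real s - real (L H)) \<ge> 0"
    by (simp add: sum_subtractf mult_ac)
  \<comment> \<open>Convexity is used through the tangent of \<open>2 powr x\<close> at
    \<open>x = 0\<close>, evaluated at \<open>x = 2 * s - L H\<close>; summed over all
    \<open>H\<close>, the linear terms are nonnegative by \<open>mean\<close>.\<close>
  have tangent: "1 + ln 2 * (2 * real s - real (L H)) \<le> 4 ^ s * (1/2) ^ L H" for H
  proof -
    have "1 + ln 2 * (2 * real s - real (L H)) \<le> exp (ln 2 * (2 * real s - real (L H)))"
      by (rule exp_ge_add_one_self)
    also have "\<dots> = 2 powr (real (2 * s) - real (L H))"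
      by (simp add: powr_def mult.commute)
    also have "\<dots> = 2 ^ (2 * s) / 2 ^ L H"
      by (simp only: powr_diff powr_realpow zero_less_numeral)
    also have "\<dots> = 4 ^ s * (1/2) ^ L H"
      by (simp add: power_mult power_divide)
    finally show ?thesis .
  qed
  have "real (card ?V) \<le> (\<Sum>H\<in>?V. 1 + ln 2 * (2 * real s - real (L H)))"
    using mean by (simp add: sum.distrib flip: sum_distrib_left)
  also have "\<dots> \<le> (\<Sum>H\<in>?V. 4 ^ s * (1/2) ^ L H)"
    by (intro sum_mono tangent)
  also have "\<dots> = 4 ^ s * (\<Sum>H\<in>?V. \<Prod>i\<in>{1..s}. (1/2) ^ (black_pegs (Q i) H + 1))"
    unfolding L_def power_sum sum_distrib_left ..
  also have "\<dots> \<le> 4 ^ s * 1"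
    using kraft_identifies_all[OF Q ident] by (intro mult_left_mono) auto
  finally have "real (card ?V) \<le> real (4 ^ s)" by simp
  then show ?thesis by (simp only: of_nat_le_iff)
qed

theorem theorem4:
  shows "\<exists>c::real. c > 0 \<and>
    (\<forall>(n::nat) (k::nat) (s::nat) (Q :: nat \<Rightarrow> nat list).
       1 \<le> n \<longrightarrow> n \<le> k \<longrightarrow>
       (\<forall>i\<in>{1..s}. Q i \<in> no_repeat_seqs n k) \<longrightarrow>
       identifies_all n k s Q \<longrightarrow>
       real s \<ge> c * real n * ln (real k))"
proof (intro exI[of _ "1 / ln 16"] conjI allI impI)
  fix n k s and Q :: "nat \<Rightarrow> nat list"
  assume n: "1 \<le> n" "n \<le> k" and Q: "\<forall>i\<in>{1..s}. Q i \<in> no_repeat_seqs n k"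
    and ident: "identifies_all n k s Q"
  \<comment> \<open>The square turns the bound \<open>4 ^ s\<close> into \<open>16 ^ s\<close>;
    taking logarithms then yields the constant \<open>1 / ln 16\<close>.\<close>
  have "k ^ n \<le> (card (no_repeat_seqs n k))\<^sup>2"
    by (rule power_le_card_no_repeat_seqs_squared[OF n(2)])
  also have "\<dots> \<le> (4 ^ s)\<^sup>2"
    using card_no_repeat_seqs_le_if_identifies_all[OF n(2) _ ident] Q by (intro power_mono) auto
  also have "\<dots> = 16 ^ s"
    by (simp flip: power_mult add: mult.commute[of s] power_mult)
  finally have "real k ^ n \<le> 16 ^ s"
    by (metis of_nat_le_iff of_nat_numeral of_nat_power)
  then have "ln (real k ^ n) \<le> ln (16 ^ s)"
    using n by (subst ln_le_cancel_iff) auto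
  then have "real n * ln (real k) \<le> real s * ln 16"
    using n by (simp add: ln_realpow)
  then show "1 / ln 16 * real n * ln (real k) \<le> real s"
    by (simp add: field_simps)
qed simp

end
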